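(* Let $T$ be a regular tournament of order $n-1$ such that $H_\omega(T)$ has exactly $3$ distinct eigenvalues. Then there exists a skew-Hadamard matrix of order $n$.
   Context: A tournament is an oriented graph whose underlying graph is complete; it is regular if all in-degrees and out-degrees of all vertices are equal. A Hadamard matrix of order $n$ is an $n\times n$ matrix $A$ with entries in $\{1,-1\}$ with $AA^\intercal=nI$; it is skew-Hadamard if moreover $A-I$ is skew-symmetric. Let $\omega=\frac{1+i\sqrt3}{2}$. The Hermitian adjacency matrix $H_\omega(T)$ has $(u,v)$-entry $\omega$ if $u\to v$, $\overline{\omega}$ if $v\to u$, and $0$ otherwise. *)

theory Defs
  imports
    "Graph_Theory.Graph_Theory"
    "Jordan_Normal_Form.Spectral_Radius"
begin

definition oriented_graph :: "('a, 'b) pre_digraph \<Rightarrow> bool" where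
  "oriented_graph T \<longleftrightarrow> digraph T \<and> (\<forall>u v. u \<rightarrow>\<^bsub>T\<^esub> v \<longrightarrow> \<not> v \<rightarrow>\<^bsub>T\<^esub> u)"

text \<open>Graph_Theory represents an undirected graph by a symmetric digraph, so the underlying
  graph of an oriented graph is its symmetrization.\<close>

definition tournament :: "('a, 'b) pre_digraph \<Rightarrow> bool" where
  "tournament T \<longleftrightarrow>
     oriented_graph T \<and> complete_digraph (card (verts T)) (with_proj (mk_symmetric T))"

definition regular_tournament :: "('a, 'b) pre_digraph \<Rightarrow> bool" where
  "regular_tournament T \<longleftrightarrow>
     tournament T \<and> (\<exists>k. \<forall>v \<in> verts T. in_degree T v = k \<and> out_degree T v = k)"

definition omega :: complex where
  "omega = (1 + \<i> * complex_of_real (sqrt 3)) / 2"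

text \<open>Matrices are indexed by natural numbers below their dimension; the list \<open>vs\<close>
  enumerates the vertices, and row and column \<open>i\<close> belong to the vertex \<open>vs ! i\<close>.\<close>

definition H_omega :: "('a, 'b) pre_digraph \<Rightarrow> 'a list \<Rightarrow> complex mat" where
  "H_omega T vs = mat (length vs) (length vs) (\<lambda>(i, j).
     if (vs ! i) \<rightarrow>\<^bsub>T\<^esub> (vs ! j) then omega
     else if (vs ! j) \<rightarrow>\<^bsub>T\<^esub> (vs ! i) then cnj omega
     else 0)"

definition hadamard_matrix :: "nat \<Rightarrow> real mat \<Rightarrow> bool" where
  "hadamard_matrix n A \<longleftrightarrow>
     A \<in> carrier_mat n n \<and> elements_mat A \<subseteq> {1, -1} \<and>
     A * transpose_mat A = of_nat n \<cdot>\<^sub>m 1\<^sub>m n"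

definition skew_symmetric_mat :: "real mat \<Rightarrow> bool" where
  "skew_symmetric_mat A \<longleftrightarrow> transpose_mat A = - A"

definition skew_hadamard_matrix :: "nat \<Rightarrow> real mat \<Rightarrow> bool" where
  "skew_hadamard_matrix n A \<longleftrightarrow> hadamard_matrix n A \<and> skew_symmetric_mat (A - 1\<^sub>m n)"

end

theory Submission
  imports
    Defs
    "HOL-Library.Z2"
    "Jordan_Normal_Form.Jordan_Normal_Form_Uniqueness"
begin

text \<open>Let \<open>m = n - 1\<close> and let \<open>S\<close> be the \<open>\<plusminus>1\<close> skew matrix of the tournament, so that
  \<open>H = (J - I) / 2 + (\<i> \<surd>3 / 2) S\<close>. Regularity makes the all-ones vector an eigenvector for
  \<open>k = (m - 1) / 2\<close>. On its orthogonal complement complex conjugation reflects the spectrum in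
  \<open>- 1/2\<close>, and \<open>- 1/2\<close> itself does not occur because \<open>J + S\<close> has odd determinant. Hence three
  eigenvalues can only be \<open>k\<close>, \<open>a\<close> and \<open>- 1 - a\<close>, with \<open>k\<close> simple. As \<open>H\<close> is Hermitian,
  \<open>(H - k) (H - a) (H + 1 + a) = 0\<close>, so the columns of \<open>(H - a) (H + 1 + a)\<close> are constant. This
  gives \<open>S\<^sup>2 = J - m I\<close>, and bordering \<open>I + S\<close> by a row of ones yields the skew-Hadamard matrix.\<close>

subsection \<open>Hermitian matrices are annihilated by the product over their spectrum\<close>

definition hermitian_mat :: "complex mat \<Rightarrow> bool" where
  "hermitian_mat A \<longleftrightarrow> transpose_mat A = map_mat cnj A"

lemma hermitian_mat_cnj:
  assumes "A \<in> carrier_mat n n" "hermitian_mat A" "i < n" "j < n"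
  shows "cnj (A $$ (i, j)) = A $$ (j, i)"
  using assms unfolding hermitian_mat_def
  by (metis carrier_matD index_map_mat(1) index_transpose_mat(1))

text \<open>Side conditions on dimensions alone leave no carrier sizes to instantiate, so long
  products can be reassociated by rewriting.\<close>

lemma assoc_mult_mat_dim:
  "dim_col A = dim_row B \<Longrightarrow> dim_col B = dim_row C \<Longrightarrow> A * B * C = A * (B * C)"
  by (rule assoc_mult_mat[of _ "dim_row A" "dim_row B" _ "dim_row C" _ "dim_col C"]) auto

text \<open>The polynomial with root list \<open>as\<close>, evaluated at \<open>A\<close>: the
  factor \<open>char_matrix A a\<close> is A - a I.\<close>

fun prod_char_matrix :: "'a :: field mat \<Rightarrow> 'a list \<Rightarrow> 'a mat" where
  "prod_char_matrix A [] = 1\<^sub>m (dim_row A)"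
| "prod_char_matrix A (a # as) = char_matrix A a * prod_char_matrix A as"

lemma prod_char_matrix_carrier [simp]:
  "A \<in> carrier_mat n n \<Longrightarrow> prod_char_matrix A as \<in> carrier_mat n n"
  by (induction as) (auto intro: mult_carrier_mat[of _ n n])

lemma char_matrix_mult_right:
  assumes "A \<in> carrier_mat n n" "B \<in> carrier_mat n n"
  shows "B * char_matrix A a = B * A + (- a) \<cdot>\<^sub>m B"
proof -
  have "B * char_matrix A a = B * A + B * ((- a) \<cdot>\<^sub>m 1\<^sub>m n)"
    unfolding char_matrix_def using assms by (subst mult_add_distrib_mat[of _ n n _ n]) auto
  then show ?thesis using assms by (simp add: mult_smult_distrib[of _ n n _ n])
qed

lemma char_matrix_mult_left:
  assumes "A \<in> carrier_mat n n" "B \<in> carrier_mat n n"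
  shows "char_matrix A a * B = A * B + (- a) \<cdot>\<^sub>m B"
proof -
  have "char_matrix A a * B = A * B + ((- a) \<cdot>\<^sub>m 1\<^sub>m n) * B"
    unfolding char_matrix_def using assms by (subst add_mult_distrib_mat[of _ n n _ _ n]) auto
  then show ?thesis using assms by (simp add: mult_smult_assoc_mat[of _ n n _ n])
qed

lemma prod_char_matrix_commute:
  assumes A: "A \<in> carrier_mat n n"
  shows "prod_char_matrix A as * A = A * prod_char_matrix A as"
proof (induction as)
  case Nil
  then show ?case using A by simp
next
  case (Cons a as)
  let ?F = "prod_char_matrix A as"
  have F: "?F \<in> carrier_mat n n" using A by simp
  have "char_matrix A a * ?F * A = char_matrix A a * (A * ?F)"
    using A F Cons by (simp add: assoc_mult_mat[of _ n n _ n _ n])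
  also have "\<dots> = (char_matrix A a * A) * ?F"
    using A F by (simp add: assoc_mult_mat[of _ n n _ n _ n])
  also have "char_matrix A a * A = A * char_matrix A a"
    using A by (simp add: char_matrix_mult_left char_matrix_mult_right)
  finally show ?case using A F by (simp add: assoc_mult_mat[of _ n n _ n _ n])
qed

text \<open>Real roots make every factor Hermitian. Transposition reverses the order of a product,
  which is harmless because all factors are polynomials in \<open>A\<close> and commute.\<close>

lemma prod_char_matrix_hermitian:
  assumes A: "A \<in> carrier_mat n n" and h: "hermitian_mat A" and r: "set as \<subseteq> \<real>"
  shows "hermitian_mat (prod_char_matrix A as)"
  using r
proof (induction as)
  case Nil
  then show ?case using A by (auto simp: hermitian_mat_def intro!: eq_matI)
next
  case (Cons a as)
  interpret cnj: comm_ring_hom cnj by unfold_locales auto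
  let ?F = "prod_char_matrix A as" and ?C = "char_matrix A a"
  have F: "?F \<in> carrier_mat n n" and C: "?C \<in> carrier_mat n n" using A by simp_all
  have a: "cnj a = a" using Cons.prems by (simp add: Reals_cnj_iff)
  have CT: "?C\<^sup>T = map_mat cnj ?C"
    using A a by (intro eq_matI) (auto simp: char_matrix_def hermitian_mat_cnj[OF A h])
  have FT: "?F\<^sup>T = map_mat cnj ?F" using Cons by (simp add: hermitian_mat_def)
  have comm: "?F * ?C = ?C * ?F"
    using A F prod_char_matrix_commute[OF A, of as]
    by (simp add: char_matrix_mult_left char_matrix_mult_right)
  have "(?C * ?F)\<^sup>T = ?F\<^sup>T * ?C\<^sup>T" by (rule transpose_mult[OF C F])
  also have "\<dots> = map_mat cnj (?F * ?C)"
    unfolding CT FT by (rule cnj.mat_hom_mult[OF F C, symmetric])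
  finally show ?case by (simp add: comm hermitian_mat_def)
qed

section \<open>Similarity, triangular matrices and traces\<close>

text \<open>Both similarities use the same \<open>P\<close> and \<open>Q\<close>, so the inner
  \<open>Q * P\<close> cancels. By induction, one Schur triangularization serves every polynomial in
  \<open>A\<close>.\<close>

lemma similar_mat_wit_mult:
  assumes "similar_mat_wit A B P Q" and "similar_mat_wit A' B' P Q"
  shows "similar_mat_wit (A * A') (B * B') P Q"
proof -
  define n where "n = dim_row P"
  have n: "dim_row A = n" "dim_row A' = n"
    using assms by (auto simp: similar_mat_wit_def n_def Let_def)
  note w = similar_mat_witD[OF n(1)[symmetric] assms(1)]
  note w' = similar_mat_witD[OF n(2)[symmetric] assms(2)]
  note c = w(5-) w'(5)
  have "A * A' = P * B * (Q * (P * (B' * Q)))"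
    unfolding w(3) w'(3)
    by (simp only: assoc_mult_mat_dim index_mult_mat carrier_matD[OF w(5)] carrier_matD[OF w(6)]
        carrier_matD[OF w(7)] carrier_matD[OF w'(5)])
  also have "Q * (P * (B' * Q)) = Q * P * (B' * Q)"
    by (simp only: assoc_mult_mat_dim index_mult_mat carrier_matD[OF w(5)] carrier_matD[OF w(6)]
        carrier_matD[OF w(7)] carrier_matD[OF w'(5)])
  also have "\<dots> = B' * Q"
    using w'(5) w(7) by (simp add: w(2))
  also have "P * B * (B' * Q) = P * (B * B') * Q"
    by (simp only: assoc_mult_mat_dim index_mult_mat carrier_matD[OF w(5)] carrier_matD[OF w(6)]
        carrier_matD[OF w(7)] carrier_matD[OF w'(5)])
  finally show ?thesis
    using w(1,2,4-) w'(4,5) by (intro similar_mat_witI[of _ _ n]) auto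
qed

lemma similar_mat_wit_prod_char_matrix:
  assumes "similar_mat_wit A B P Q"
  shows "similar_mat_wit (prod_char_matrix A as) (prod_char_matrix B as) P Q"
proof (induction as)
  case Nil
  note w = similar_mat_witD[OF refl assms]
  have "dim_row B = dim_row A" using w(5) by simp
  then have "prod_char_matrix B [] = 1\<^sub>m (dim_row A)" by simp
  then show ?case
    using w(1,2,6,7) by (intro similar_mat_witI[of _ _ "dim_row A"]) simp_all
next
  case (Cons a as)
  then show ?case
    using similar_mat_wit_mult[OF similar_mat_wit_char_matrix[OF assms]] by simp
qed

text \<open>A term \<open>A $$ (i, l) * B $$ (l, j)\<close> can be nonzero only for i \<le> l \<le>
  j: never below the diagonal, and on the diagonal only for l = i.\<close>

lemma upper_triangular_mult:
  fixes A B :: "'a :: semiring_0 mat"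
  assumes A: "A \<in> carrier_mat n n" "upper_triangular A"
    and B: "B \<in> carrier_mat n n" "upper_triangular B"
  shows "upper_triangular (A * B)"
    and "i < n \<Longrightarrow> (A * B) $$ (i, i) = A $$ (i, i) * B $$ (i, i)"
proof -
  have z: "A $$ (i, l) * B $$ (l, j) = 0" if "j < l \<or> l < i" "i < n" "l < n" for i j l
    using that A B by (metis carrier_matD(1) mult_zero_left mult_zero_right upper_triangularD)
  show "upper_triangular (A * B)"
  proof (rule upper_triangularI)
    fix i j assume ij: "j < i" "i < dim_row (A * B)"
    then have "(A * B) $$ (i, j) = (\<Sum>l = 0..<n. A $$ (i, l) * B $$ (l, j))"
      using A B by (simp add: scalar_prod_def)
    also have "\<dots> = 0" using ij A B by (intro sum.neutral ballI z) auto
    finally show "(A * B) $$ (i, j) = 0" .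
  qed
  assume i: "i < n"
  then have "(A * B) $$ (i, i) = (\<Sum>l = 0..<n. A $$ (i, l) * B $$ (l, i))"
    using A B by (simp add: scalar_prod_def)
  also have "\<dots> = (\<Sum>l \<in> {i}. A $$ (i, l) * B $$ (l, i))"
    using i by (intro sum.mono_neutral_right ballI z) auto
  finally show "(A * B) $$ (i, i) = A $$ (i, i) * B $$ (i, i)" by simp
qed

lemma prod_char_matrix_upper_triangular:
  assumes B: "B \<in> carrier_mat n n" "upper_triangular B"
  shows "upper_triangular (prod_char_matrix B as)"
    and "i < n \<Longrightarrow> prod_char_matrix B as $$ (i, i) = (\<Prod>a\<leftarrow>as. B $$ (i, i) - a)"
proof -
  have ut: "upper_triangular (char_matrix B a)" for a
    using B unfolding upper_triangular_def by (auto simp: char_matrix_def)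
  have "upper_triangular (prod_char_matrix B as) \<and>
    (\<forall>i<n. prod_char_matrix B as $$ (i, i) = (\<Prod>a\<leftarrow>as. B $$ (i, i) - a))"
  proof (induction as)
    case Nil
    then show ?case using B by simp
  next
    case (Cons a as)
    have d: "char_matrix B a $$ (i, i) = B $$ (i, i) - a" if "i < n" for i
      using that B by (simp add: char_matrix_def)
    show ?case
      using Cons upper_triangular_mult[OF char_matrix_closed[OF B(1), of a] ut
        prod_char_matrix_carrier[OF B(1), of as]] by (simp add: d)
  qed
  then show "upper_triangular (prod_char_matrix B as)"
    "i < n \<Longrightarrow> prod_char_matrix B as $$ (i, i) = (\<Prod>a\<leftarrow>as. B $$ (i, i) - a)" by auto
qed

lemma trace_mult_commute:
  fixes A B :: "'a :: comm_semiring_0 mat"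
  assumes "A \<in> carrier_mat n m" "B \<in> carrier_mat m n"
  shows "(\<Sum>i<n. (A * B) $$ (i, i)) = (\<Sum>i<m. (B * A) $$ (i, i))"
proof -
  have "(\<Sum>i<n. (A * B) $$ (i, i)) = (\<Sum>i<n. \<Sum>j<m. A $$ (i, j) * B $$ (j, i))"
    using assms by (intro sum.cong) (auto simp: scalar_prod_def atLeast0LessThan)
  also have "\<dots> = (\<Sum>j<m. \<Sum>i<n. B $$ (j, i) * A $$ (i, j))"
    by (subst sum.swap) (simp add: mult.commute)
  also have "\<dots> = (\<Sum>i<m. (B * A) $$ (i, i))"
    using assms by (intro sum.cong) (auto simp: scalar_prod_def atLeast0LessThan)
  finally show ?thesis .
qed

lemma trace_similar:
  fixes A B :: "'a :: comm_ring_1 mat"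
  assumes A: "A \<in> carrier_mat n n" and w: "similar_mat_wit A B P Q"
  shows "(\<Sum>i<n. A $$ (i, i)) = (\<Sum>i<n. B $$ (i, i))"
proof -
  note wD = similar_mat_witD2[OF A w]
  have "(\<Sum>i<n. A $$ (i, i)) = (\<Sum>i<n. (Q * (P * B)) $$ (i, i))"
    unfolding wD(3) using wD(5-) by (intro trace_mult_commute) auto
  also have "Q * (P * B) = B"
    using wD(5-) by (simp add: wD(2) flip: assoc_mult_mat[of Q n n P n B n])
  finally show ?thesis .
qed

lemma hermitian_trace_square_eq_0:
  assumes A: "A \<in> carrier_mat n n" "hermitian_mat A"
    and tr: "(\<Sum>i<n. (A * A) $$ (i, i)) = 0"
  shows "A = 0\<^sub>m n n"
proof -
  have "(\<Sum>i<n. (A * A) $$ (i, i)) = (\<Sum>i<n. \<Sum>j<n. A $$ (i, j) * A $$ (j, i))"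
    using A by (intro sum.cong) (auto simp: scalar_prod_def atLeast0LessThan)
  also have "\<dots> = (\<Sum>i<n. \<Sum>j<n. of_real ((cmod (A $$ (i, j)))\<^sup>2))"
    by (intro sum.cong refl) (simp add: hermitian_mat_cnj[OF A] complex_norm_square del: of_real_power)
  finally have "of_real (\<Sum>i<n. \<Sum>j<n. (cmod (A $$ (i, j)))\<^sup>2) = (0 :: complex)"
    using tr by simp
  then have z: "(\<Sum>i<n. \<Sum>j<n. (cmod (A $$ (i, j)))\<^sup>2) = 0" by (simp only: of_real_eq_0_iff)
  have "A $$ (i, j) = 0" if "i < n" "j < n" for i j
  proof -
    have "(\<Sum>j<n. (cmod (A $$ (i, j)))\<^sup>2) = 0"
      using z that by (subst (asm) sum_nonneg_eq_0_iff) (auto intro: sum_nonneg)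
    then show ?thesis using that by (subst (asm) sum_nonneg_eq_0_iff) auto
  qed
  then show ?thesis using A by (intro eq_matI) auto
qed

text \<open>By Schur triangularization \<open>M = \<Prod>\<^sub>a (A - a)\<close> is similar to a strictly upper triangular
  matrix, so \<open>M\<^sup>2\<close> has trace 0; as \<open>M\<close> is Hermitian, this trace is the sum of the squared
  moduli of its entries.\<close>

theorem hermitian_prod_char_matrix_eq_0:
  assumes A: "A \<in> carrier_mat n n" "hermitian_mat A"
    and spec: "spectrum A \<subseteq> set as" and r: "set as \<subseteq> \<real>"
  shows "prod_char_matrix A as = 0\<^sub>m n n"
proof -
  obtain es where es: "char_poly A = (\<Prod>a\<leftarrow>es. [:- a, 1:])"
    using char_poly_factorized[OF A(1)] by blast
  obtain B P Q where "schur_decomposition A es = (B, P, Q)" by (metis prod_cases3)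
  from schur_decomposition[OF A(1) es this]
  have w: "similar_mat_wit A B P Q" and ut: "upper_triangular B" and dB: "diag_mat B = es"
    by auto
  note wD = similar_mat_witD2[OF A(1) w]
  let ?M = "prod_char_matrix A as" and ?N = "prod_char_matrix B as"
  have cN: "?N \<in> carrier_mat n n" and cM: "?M \<in> carrier_mat n n" using wD A by simp_all
  \<comment> \<open>A diagonal entry of \<open>B\<close> is a root of the characteristic polynomial,
    hence a member of \<open>as\<close>, and kills one factor of the diagonal entry of
    \<open>?N\<close>.\<close>
  have N0: "?N $$ (i, i) = 0" if i: "i < n" for i
  proof -
    have "B $$ (i, i) \<in> set es"
      using dB i wD(5) by (force simp: diag_mat_def)
    then have "poly (char_poly A) (B $$ (i, i)) = 0"
      by (auto simp: es poly_prod_list prod_list_zero_iff)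
    then have "B $$ (i, i) \<in> set as"
      using spec by (auto simp: spectrum_root_char_poly[OF A(1)])
    then show ?thesis
      using prod_char_matrix_upper_triangular(2)[OF wD(5) ut i, of as]
      by (auto simp: prod_list_zero_iff)
  qed
  note wM = similar_mat_wit_prod_char_matrix[OF w, of as]
  have "(\<Sum>i<n. (?M * ?M) $$ (i, i)) = (\<Sum>i<n. (?N * ?N) $$ (i, i))"
    using cM by (intro trace_similar[OF _ similar_mat_wit_mult[OF wM wM]]) auto
  also have "(\<Sum>i<n. (?N * ?N) $$ (i, i)) = 0"
    using upper_triangular_mult(2)[OF cN _ cN]
      prod_char_matrix_upper_triangular(1)[OF wD(5) ut, of as] N0
    by (intro sum.neutral) auto
  finally show ?thesis
    using hermitian_trace_square_eq_0[OF cM prod_char_matrix_hermitian[OF A r]] by simp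
qed

section \<open>Real eigenvalues, odd determinants and eigenvector equations\<close>

text \<open>The quadratic form \<open>q\<close> of \<open>A\<close> at an eigenvector equals
  \<open>a\<close> times the squared norm \<open>N\<close>, and is its own conjugate since
  \<open>A\<close> is Hermitian. As \<open>N\<close> is nonzero, \<open>a\<close> is real.\<close>

lemma hermitian_eigenvalue_real:
  assumes A: "A \<in> carrier_mat n n" "hermitian_mat A" and "eigenvalue A a"
  shows "a \<in> \<real>"
proof -
  obtain v where v: "v \<in> carrier_vec n" "v \<noteq> 0\<^sub>v n" "A *\<^sub>v v = a \<cdot>\<^sub>v v"
    using assms by (auto simp: eigenvalue_def eigenvector_def)
  have ev: "(\<Sum>j<n. A $$ (i, j) * v $ j) = a * v $ i" if "i < n" for i
    using arg_cong[OF v(3), of "\<lambda>w. w $ i"] that A v(1)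
    by (simp add: scalar_prod_def atLeast0LessThan)
  define q where "q = (\<Sum>i<n. \<Sum>j<n. cnj (v $ i) * A $$ (i, j) * v $ j)"
  define N where "N = (\<Sum>i<n. (cmod (v $ i))\<^sup>2)"
  have "q = (\<Sum>i<n. cnj (v $ i) * (a * v $ i))"
    unfolding q_def by (intro sum.cong refl) (simp add: mult.assoc flip: ev sum_distrib_left)
  also have "\<dots> = a * of_real N"
    by (simp add: N_def sum_distrib_left complex_norm_square ac_simps del: of_real_power)
  finally have qa: "q = a * of_real N" .
  have "cnj q = (\<Sum>i<n. \<Sum>j<n. v $ i * A $$ (j, i) * cnj (v $ j))"
    unfolding q_def cnj_sum by (intro sum.cong refl) (simp add: hermitian_mat_cnj[OF A])
  also have "\<dots> = q"
    unfolding q_def by (subst sum.swap) (simp add: ac_simps)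
  finally have "cnj a * of_real N = a * of_real N" using qa by simp
  moreover have "N \<noteq> 0"
  proof
    assume "N = 0"
    then have "v $ i = 0" if "i < n" for i
      using that unfolding N_def by (subst (asm) sum_nonneg_eq_0_iff) auto
    then have "v = 0\<^sub>v n" using v(1) by (intro eq_vecI) auto
    then show False using v(2) by simp
  qed
  ultimately show ?thesis by (simp add: Reals_cnj_iff)
qed

text \<open>Reduction modulo 2 commutes with the determinant and turns \<open>M\<close> into the
  identity matrix over \<open>bit\<close>, so the determinant is odd.\<close>

lemma det_nonzero_if_odd:
  fixes M :: "int mat"
  assumes M: "M \<in> carrier_mat n n"
    and diag: "\<And>i. i < n \<Longrightarrow> odd (M $$ (i, i))"
    and off: "\<And>i j. i < n \<Longrightarrow> j < n \<Longrightarrow> i \<noteq> j \<Longrightarrow> even (M $$ (i, j))"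
  shows "det M \<noteq> 0"
proof -
  interpret h: comm_ring_hom "of_int :: int \<Rightarrow> bit" by unfold_locales auto
  have parity: "(of_int x :: bit) = of_bool (odd x)" for x
    by (cases "even x") (auto elim!: evenE oddE)
  have "map_mat (of_int :: int \<Rightarrow> bit) M = 1\<^sub>m n"
    using assms by (intro eq_matI) (auto simp: parity)
  then have "(of_int (det M) :: bit) = 1" by (metis of_int_hom.hom_det det_one)
  then show ?thesis by auto
qed

text \<open>Replaces vectors by functions on indices, so that eigenvector equations become plain
  finite sums.\<close>

lemma eigenvalue_mat_iff:
  "eigenvalue (mat n n (\<lambda>(i, j). h i j)) a \<longleftrightarrow>
    (\<exists>v. (\<exists>i<n. v i \<noteq> 0) \<and> (\<forall>i<n. (\<Sum>j<n. h i j * v j) = a * v i))"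
proof
  assume "eigenvalue (mat n n (\<lambda>(i, j). h i j)) a"
  then obtain v where v: "v \<in> carrier_vec n" "v \<noteq> 0\<^sub>v n"
    "mat n n (\<lambda>(i, j). h i j) *\<^sub>v v = a \<cdot>\<^sub>v v"
    by (auto simp: eigenvalue_def eigenvector_def)
  have "\<exists>i<n. v $ i \<noteq> 0" using v(1,2) by (metis carrier_vecD eq_vecI index_zero_vec)
  moreover have "(\<Sum>j<n. h i j * v $ j) = a * v $ i" if "i < n" for i
    using arg_cong[OF v(3), of "\<lambda>w. w $ i"] that v(1)
    by (simp add: scalar_prod_def atLeast0LessThan)
  ultimately show "\<exists>v. (\<exists>i<n. v i \<noteq> 0) \<and> (\<forall>i<n. (\<Sum>j<n. h i j * v j) = a * v i)"
    by (intro exI[of _ "\<lambda>i. v $ i"]) auto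
next
  assume "\<exists>v. (\<exists>i<n. v i \<noteq> 0) \<and> (\<forall>i<n. (\<Sum>j<n. h i j * v j) = a * v i)"
  then obtain v k where v: "k < n" "v k \<noteq> 0" "\<forall>i<n. (\<Sum>j<n. h i j * v j) = a * v i"
    by blast
  have "vec n v \<noteq> 0\<^sub>v n" using v(1,2) by (metis index_vec index_zero_vec(1))
  moreover have "mat n n (\<lambda>(i, j). h i j) *\<^sub>v vec n v = a \<cdot>\<^sub>v vec n v"
    using v(3) by (intro eq_vecI) (auto simp: scalar_prod_def atLeast0LessThan)
  ultimately show "eigenvalue (mat n n (\<lambda>(i, j). h i j)) a"
    unfolding eigenvalue_def eigenvector_def by (intro exI[of _ "vec n v"]) auto
qed

subsection \<open>Seidel matrices of regular tournaments\<close>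

text \<open>The entries are integers so that determinants can be reduced modulo 2; skewness forces a
  zero diagonal.\<close>

locale regular_sign_matrix =
  fixes m :: nat and s :: "nat \<Rightarrow> nat \<Rightarrow> int"
  assumes skew: "i < m \<Longrightarrow> j < m \<Longrightarrow> s j i = - s i j"
    and sign: "i < m \<Longrightarrow> j < m \<Longrightarrow> i \<noteq> j \<Longrightarrow> s i j = 1 \<or> s i j = - 1"
    and row_sum: "i < m \<Longrightarrow> (\<Sum>j<m. s i j) = 0"
begin

definition h :: "nat \<Rightarrow> nat \<Rightarrow> complex" where
  "h i j = (of_bool (i \<noteq> j) + \<i> * complex_of_real (sqrt 3) * of_int (s i j)) / 2"

abbreviation H :: "complex mat" where
  "H \<equiv> mat m m (\<lambda>(i, j). h i j)"

text \<open>The common row sum of \<open>H\<close>, since the row sums of \<open>s\<close> vanish;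
  for a regular tournament it is the common out-degree.\<close>

definition valency :: complex where
  "valency = (of_nat m - 1) / 2"

lemma s_diag [simp]: "i < m \<Longrightarrow> s i i = 0"
  using skew[of i i] by simp

lemma s_square: "i < m \<Longrightarrow> j < m \<Longrightarrow> s i j * s i j = of_bool (i \<noteq> j)"
  using sign[of i j] by (cases "i = j") auto

lemma col_sum: "j < m \<Longrightarrow> (\<Sum>i<m. s i j) = 0"
  by (subst sum.cong[OF refl skew[of j]]) (simp_all add: row_sum sum_negf)

text \<open>This is H = (J - I + \<i> \<surd>3 S) / 2 applied to a vector, with J the all-ones
  matrix and S the matrix of \<open>s\<close>.\<close>

lemma sum_h:
  assumes "i < m"
  shows "(\<Sum>j<m. h i j * v j) =
    ((\<Sum>j<m. v j) - v i + \<i> * complex_of_real (sqrt 3) * (\<Sum>j<m. of_int (s i j) * v j)) / 2"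
proof -
  have "(\<Sum>j<m. h i j * v j) = (\<Sum>j<m. (v j - (if i = j then v j else 0) +
      \<i> * complex_of_real (sqrt 3) * (of_int (s i j) * v j)) / 2)"
    by (intro sum.cong refl) (simp add: h_def field_simps)
  also have "\<dots> = ((\<Sum>j<m. v j) - v i +
      \<i> * complex_of_real (sqrt 3) * (\<Sum>j<m. of_int (s i j) * v j)) / 2"
    using assms
    by (simp add: sum.distrib sum_subtractf sum_distrib_left flip: sum_divide_distrib)
  finally show ?thesis .
qed

lemma cnj_h: "i < m \<Longrightarrow> j < m \<Longrightarrow> cnj (h i j) = h j i"
  using skew[of i j] by (auto simp: h_def)

lemma hermitian_H: "hermitian_mat H"
  unfolding hermitian_mat_def by (intro eq_matI) (auto simp: cnj_h)

section \<open>Eigenvalues and eigenvectors of \<open>H\<close>\<close>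

lemma eigenvalue_valency:
  assumes "0 < m"
  shows "eigenvalue H valency"
  unfolding eigenvalue_mat_iff
proof (intro exI[of _ "\<lambda>_. 1"] conjI allI impI)
  show "\<exists>i<m. (1 :: complex) \<noteq> 0" using assms by auto
  fix i assume "i < m"
  then show "(\<Sum>j<m. h i j * 1) = valency * 1"
    unfolding sum_h[OF \<open>i < m\<close>] valency_def by (simp add: row_sum flip: of_int_sum)
qed

text \<open>All columns of \<open>H\<close> sum to \<open>valency\<close>, so adding up the
  eigenvector equations gives \<open>a\<close> times the sum on one side and \<open>valency\<close>
  times the sum on the other.\<close>

lemma eigenvector_sum_eq_0:
  assumes ev: "\<And>i. i < m \<Longrightarrow> (\<Sum>j<m. h i j * v j) = a * v i" and "a \<noteq> valency"
  shows "(\<Sum>j<m. v j) = 0"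
proof -
  have col: "(\<Sum>i<m. h i j) = valency" if j: "j < m" for j
  proof -
    have "(\<Sum>i<m. h i j) = cnj (\<Sum>i<m. h j i * 1)"
      using j by (simp add: cnj_h)
    also have "\<dots> = valency"
      unfolding sum_h[OF j] valency_def using j by (simp add: row_sum flip: of_int_sum)
    finally show ?thesis .
  qed
  have "a * (\<Sum>i<m. v i) = (\<Sum>i<m. \<Sum>j<m. h i j * v j)"
    by (simp add: ev sum_distrib_left)
  also have "\<dots> = (\<Sum>j<m. \<Sum>i<m. h i j * v j)" by (rule sum.swap)
  also have "\<dots> = valency * (\<Sum>j<m. v j)"
    by (simp add: col sum_distrib_left flip: sum_distrib_right)
  finally show ?thesis using assms(2) by simp
qed

text \<open>On the orthogonal complement of the all-ones vector \<open>H\<close> acts as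
  \<open>- 1/2 + (\<i> \<surd>3 / 2) S\<close> with \<open>S\<close> real, so conjugation reflects its spectrum there in \<open>- 1/2\<close>.\<close>

lemma eigenvalue_reflect:
  assumes ev: "\<And>i. i < m \<Longrightarrow> (\<Sum>j<m. h i j * v j) = a * v i"
    and nz: "\<exists>i<m. v i \<noteq> 0" and sum: "(\<Sum>j<m. v j) = 0"
  shows "eigenvalue H (- 1 - cnj a)"
  unfolding eigenvalue_mat_iff
proof (intro exI[of _ "\<lambda>i. cnj (v i)"] conjI allI impI)
  show "\<exists>i<m. cnj (v i) \<noteq> 0" using nz by simp
  fix i assume i: "i < m"
  define t where "t = (\<Sum>j<m. of_int (s i j) * v j)"
  have "(\<Sum>j<m. cnj (v j)) = 0" using sum by (simp flip: cnj_sum)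
  then have 1: "(\<Sum>j<m. h i j * cnj (v j)) =
      (- cnj (v i) + \<i> * complex_of_real (sqrt 3) * cnj t) / 2"
    unfolding sum_h[OF i] t_def by simp
  have "a * v i = (- v i + \<i> * complex_of_real (sqrt 3) * t) / 2"
    using ev[OF i] unfolding sum_h[OF i] t_def sum by simp
  then have "cnj (a * v i) = cnj ((- v i + \<i> * complex_of_real (sqrt 3) * t) / 2)"
    by (rule arg_cong)
  then have 2: "cnj a * cnj (v i) = (- cnj (v i) - \<i> * complex_of_real (sqrt 3) * cnj t) / 2"
    by simp
  show "(\<Sum>j<m. h i j * cnj (v j)) = (- 1 - cnj a) * cnj (v i)"
    unfolding left_diff_distrib 1 2 by (simp add: field_simps)
qed

text \<open>An eigenvector for \<open>- 1/2\<close> orthogonal to the all-ones vector would be in the kernel of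
  \<open>J + S\<close>, which modulo 2 is the identity matrix.\<close>

lemma eigenvalue_neq_minus_half:
  assumes ev: "\<And>i. i < m \<Longrightarrow> (\<Sum>j<m. h i j * v j) = a * v i"
    and nz: "\<exists>i<m. v i \<noteq> 0" and sum: "(\<Sum>j<m. v j) = 0"
  shows "a \<noteq> - 1 / 2"
proof
  assume a: "a = - 1 / 2"
  define M where "M = mat m m (\<lambda>(i, j). 1 + s i j)"
  have M: "M \<in> carrier_mat m m" by (simp add: M_def)
  have "even (1 + s i j)" if "i < m" "j < m" "i \<noteq> j" for i j
    using sign[OF that] by auto
  then have "det M \<noteq> 0"
    by (intro det_nonzero_if_odd[OF M]) (auto simp: M_def)
  then have "det (map_mat complex_of_int M) \<noteq> 0" by (simp add: of_int_hom.hom_det)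
  moreover have "map_mat complex_of_int M *\<^sub>v vec m v = 0\<^sub>v m"
  proof (rule eq_vecI)
    fix i assume "i < dim_vec (0\<^sub>v m :: complex vec)"
    then have i: "i < m" by simp
    \<comment> \<open>At a = - 1/2 the terms in \<open>v i\<close> cancel, which leaves only the
      contribution of S.\<close>
    have "(\<Sum>j<m. of_int (s i j) * v j) = 0"
      using ev[OF i] unfolding sum_h[OF i] sum a by simp
    moreover have "(map_mat complex_of_int M *\<^sub>v vec m v) $ i =
        (\<Sum>j<m. v j + of_int (s i j) * v j)"
      using i by (simp add: M_def scalar_prod_def atLeast0LessThan algebra_simps)
    ultimately show "(map_mat complex_of_int M *\<^sub>v vec m v) $ i = 0\<^sub>v m $ i"
      using i sum by (simp add: sum.distrib)
  qed (simp add: M_def)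
  moreover have "vec m v \<noteq> 0\<^sub>v m" using nz by (metis index_vec index_zero_vec(1))
  moreover have "map_mat complex_of_int M \<in> carrier_mat m m" using M by simp
  ultimately show False
    using det_0_iff_vec_prod_zero vec_carrier by blast
qed

lemma spectrum_H_eq:
  assumes card: "card (spectrum H) = 3"
  obtains a where "a \<noteq> valency" and "- 1 - a \<noteq> valency"
    and "spectrum H = {valency, a, - 1 - a}" and "spectrum H \<subseteq> \<real>"
proof -
  have "m \<noteq> 0"
  proof
    assume "m = 0"
    then have "spectrum H = {}" unfolding spectrum_def eigenvalue_mat_iff by simp
    then show False using card by simp
  qed
  then have k: "valency \<in> spectrum H" using eigenvalue_valency by (simp add: spectrum_def)
  have real: "spectrum H \<subseteq> \<real>"
    using hermitian_eigenvalue_real[of H m] hermitian_H by (auto simp: spectrum_def)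
  have refl: "- 1 - x \<in> spectrum H \<and> - 1 - x \<noteq> x" if "x \<in> spectrum H" "x \<noteq> valency" for x
  proof -
    from that(1) obtain v where v: "\<exists>i<m. v i \<noteq> 0"
      and ev: "\<And>i. i < m \<Longrightarrow> (\<Sum>j<m. h i j * v j) = x * v i"
      unfolding spectrum_def eigenvalue_mat_iff by blast
    note sum = eigenvector_sum_eq_0[OF ev that(2)]
    have "x \<noteq> - 1 / 2" by (rule eigenvalue_neq_minus_half[OF ev v sum])
    \<comment> \<open>Since eigenvalues are real, the conjugate in the reflection
      disappears.\<close>
    moreover have "- 1 - x \<in> spectrum H"
      using eigenvalue_reflect[OF ev v sum] real that(1)
      by (auto simp: spectrum_def Reals_cnj_iff subset_iff)
    moreover have "x = - 1 / 2" if "- 1 - x = x"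
      using that by (simp add: field_simps)
    ultimately show ?thesis by blast
  qed
  have "finite (spectrum H)" using card by (metis card.infinite zero_neq_numeral)
  then have "card (spectrum H - {valency}) = 2" using card k by simp
  then obtain a b where ab: "spectrum H - {valency} = {a, b}" "a \<noteq> b"
    by (meson card_2_iff)
  then have spec: "spectrum H = {valency, a, b}" "a \<noteq> valency" "b \<noteq> valency" using k by auto
  \<comment> \<open>A reflected eigenvalue might be \<open>valency\<close>. If either reflection
    avoids it, then b = - 1 - a; if both equal it, then a = b, a contradiction.\<close>
  have "- 1 - a \<in> {valency, b}" "- 1 - b \<in> {valency, a}"
    using refl[of a] refl[of b] spec ab(2) by auto
  moreover have "x = - 1 - (- 1 - x)" for x :: complex by simp
  ultimately have "b = - 1 - a" using ab(2) by (metis insertE singletonD)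
  then show ?thesis using that spec real by blast
qed

section \<open>The square of the sign matrix\<close>

text \<open>The columns of \<open>Q\<close> are killed by H - \<open>valency\<close>, hence
  constant. Off the diagonal an entry of \<open>Q\<close> is an affine function of the entry of S
  squared, so each column of S squared is constant off the diagonal; its diagonal entry and zero sum
  then fix that constant.\<close>

lemma sum_s_mult:
  assumes card: "card (spectrum H) = 3" and i: "i < m" and j: "j < m"
  shows "(\<Sum>l<m. s i l * s l j) = (if i = j then 1 - int m else 1)"
proof -
  have diag: "(\<Sum>l<m. s j l * s l j) = 1 - int m" if "j < m" for j
  proof -
    have "(\<Sum>l<m. s j l * s l j) = (\<Sum>l<m. - 1 + of_bool (l = j))"
      using that skew[of j] s_square[of j] by (intro sum.cong refl) (auto simp: of_bool_def)
    also have "\<dots> = 1 - int m" using that by (simp add: sum.distrib of_bool_def del: add_uminus_conv_diff uminus_add_conv_diff)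
    finally show ?thesis .
  qed
  obtain a where a: "a \<noteq> valency" "- 1 - a \<noteq> valency"
    and spec: "spectrum H = {valency, a, - 1 - a}" and real: "spectrum H \<subseteq> \<real>"
    using spectrum_H_eq[OF card] .
  define Q where "Q = char_matrix H a * char_matrix H (- 1 - a)"
  have H: "H \<in> carrier_mat m m" by simp
  have Q: "Q \<in> carrier_mat m m" unfolding Q_def by (intro mult_carrier_mat[of _ m m]) auto
  have "prod_char_matrix H [valency, a, - 1 - a] = 0\<^sub>m m m"
    using spec real by (intro hermitian_prod_char_matrix_eq_0[OF H hermitian_H]) auto
  then have "char_matrix H valency * Q = 0\<^sub>m m m"
    using right_mult_one_mat[of "char_matrix H (- 1 - a)" m m] by (simp add: Q_def)
  then have HQ: "H * Q + (- valency) \<cdot>\<^sub>m Q = 0\<^sub>m m m"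
    by (simp add: char_matrix_mult_left[OF H Q])
  have evQ: "(\<Sum>l<m. h i l * Q $$ (l, j)) = valency * Q $$ (i, j)" if "i < m" for i
    using arg_cong[OF HQ, of "\<lambda>X. X $$ (i, j)"] that j Q
    by (simp add: scalar_prod_def atLeast0LessThan)
  \<comment> \<open>Together with the conditions on \<open>a\<close>, this keeps - 1 -
    \<open>valency\<close> out of the spectrum.\<close>
  have valency_ne: "- 1 - valency \<noteq> valency"
  proof
    assume "- 1 - valency = valency"
    then have "of_nat m = (0 :: complex)" by (simp add: valency_def field_simps)
    then show False using i by simp
  qed
  have const: "Q $$ (i, j) = Q $$ (i', j)" if i: "i < m" "i' < m" for i i'
  proof -
    \<comment> \<open>Here \<open>c\<close> is the mean of column \<open>j\<close>, so
      \<open>w\<close> has sum zero and still satisfies the eigenvector equation for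
      \<open>valency\<close>. If \<open>w\<close> were nonzero, reflection would make - 1 -
      \<open>valency\<close> an eigenvalue.\<close>
    define c where "c = (\<Sum>l<m. Q $$ (l, j)) / of_nat m"
    define w where "w l = Q $$ (l, j) - c" for l
    have sum: "(\<Sum>l<m. w l) = 0" using i by (simp add: w_def sum_subtractf c_def)
    have one: "(\<Sum>l<m. h i l) = valency" if "i < m" for i
      using sum_h[OF that, of "\<lambda>_. 1"] that
      by (simp add: valency_def row_sum flip: of_int_sum)
    have ev: "(\<Sum>l<m. h i l * w l) = valency * w i" if "i < m" for i
      using that
      by (simp add: w_def right_diff_distrib sum_subtractf evQ one flip: sum_distrib_right)
    have "w l = 0" if "l < m" for l
    proof (rule ccontr)
      assume "w l \<noteq> 0"
      then have "eigenvalue H (- 1 - cnj valency)"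
        using that by (intro eigenvalue_reflect[OF ev _ sum]) auto
      then have "- 1 - valency \<in> spectrum H" by (simp add: spectrum_def valency_def)
      then have "- 1 - valency = a \<or> - 1 - valency = - 1 - a"
        using spec valency_ne by auto
      then show False using a by auto
    qed
    then show ?thesis using i by (simp add: w_def)
  qed
  have entry: "Q $$ (i, j) = of_nat m / 4 - 3 / 4 * of_int (\<Sum>l<m. s i l * s l j)"
    if i: "i < m" "i \<noteq> j" for i
  proof -
    \<comment> \<open>Centring at - 1/2: \<open>g\<close> is \<open>h\<close> with diagonal 1/2
      instead of 0, so the factors of \<open>Q\<close> become G - b I and G + b I. For i \<noteq> j
      the cross terms cancel and the square of \<open>b\<close> does not occur, leaving the entry of
      G squared.\<close>
    define b where "b = a + 1 / 2"
    define g where "g i l = (1 + \<i> * complex_of_real (sqrt 3) * of_int (s i l)) / 2" for i l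
    have "Q $$ (i, j) = (\<Sum>l<m. (h i l - (if l = i then a else 0)) *
        (h l j - (if l = j then - 1 - a else 0)))"
      using i j unfolding Q_def char_matrix_def
      by (simp add: scalar_prod_def atLeast0LessThan)
        (intro sum.cong refl, auto)
    also have "\<dots> = (\<Sum>l<m. (g i l - (if l = i then b else 0)) *
        (g l j + (if l = j then b else 0)))"
      by (intro sum.cong refl) (auto simp: h_def g_def b_def field_simps)
    also have "\<dots> = (\<Sum>l<m. g i l * g l j + (if l = j then g i l * b else 0)
        - (if l = i then b * g l j else 0))"
      using i by (intro sum.cong refl) (auto simp: algebra_simps)
    also have "\<dots> = (\<Sum>l<m. g i l * g l j)"
      using i j by (simp add: sum.distrib sum_subtractf)
    also have "\<dots> = (\<Sum>l<m. 1 / 4 + \<i> * complex_of_real (sqrt 3) / 4 * of_int (s i l)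
        + \<i> * complex_of_real (sqrt 3) / 4 * of_int (s l j) - 3 / 4 * of_int (s i l * s l j))"
    proof (intro sum.cong refl)
      fix l
      have "complex_of_real (sqrt 3) * complex_of_real (sqrt 3) = 3"
        by (simp flip: of_real_mult)
      then have "(1 + \<i> * complex_of_real (sqrt 3) * x) / 2 * ((1 + \<i> * complex_of_real (sqrt 3) * y) / 2) =
          1 / 4 + \<i> * complex_of_real (sqrt 3) / 4 * x + \<i> * complex_of_real (sqrt 3) / 4 * y
          - 3 / 4 * (x * y)" for x y
        using i_squared by (simp add: field_simps) algebra
      then show "g i l * g l j = 1 / 4 + \<i> * complex_of_real (sqrt 3) / 4 * of_int (s i l)
        + \<i> * complex_of_real (sqrt 3) / 4 * of_int (s l j) - 3 / 4 * of_int (s i l * s l j)"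
        by (simp add: g_def)
    qed
    also have "\<dots> = of_nat m / 4 - 3 / 4 * of_int (\<Sum>l<m. s i l * s l j)"
      unfolding sum.distrib sum_subtractf sum_distrib_left[symmetric] of_int_sum[symmetric]
      using row_sum[OF i(1)] col_sum[OF j] by simp
    finally show ?thesis .
  qed
  define q where "q i = (\<Sum>l<m. s i l * s l j)" for i
  have q_const: "q i' = q i" if "i < m" "i' < m" "i \<noteq> j" "i' \<noteq> j" for i i'
  proof -
    have "of_int (q i) = (of_int (q i') :: complex)"
      using entry[OF that(1,3)] entry[OF that(2,4)] const[OF that(1,2)]
      by (simp add: q_def)
    then show ?thesis by simp
  qed
  have "(\<Sum>i<m. q i) = (\<Sum>l<m. \<Sum>i<m. s i l * s l j)"
    unfolding q_def by (rule sum.swap)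
  also have "\<dots> = 0" by (simp add: col_sum flip: sum_distrib_right)
  finally have q_sum: "(\<Sum>i<m. q i) = 0" .
  show ?thesis
  proof (cases "i = j")
    case True
    then show ?thesis using diag[OF j] by simp
  next
    case False
    \<comment> \<open>The column sum reads 0 = (1 - m) + (m - 1) x with x the common off-diagonal
      value. Two distinct indices exist, so m - 1 is nonzero and x = 1.\<close>
    have "0 = q j + (\<Sum>l\<in>{..<m} - {j}. q l)"
      using q_sum j by (simp add: sum.remove[of _ j])
    also have "(\<Sum>l\<in>{..<m} - {j}. q l) = (\<Sum>l\<in>{..<m} - {j}. q i)"
      using q_const[OF i _ False] by (intro sum.cong) auto
    also have "\<dots> = (int m - 1) * q i" using j by (simp add: of_nat_diff)
    also have "q j = 1 - int m" using diag[OF j] by (simp add: q_def)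
    finally have "(int m - 1) * (q i - 1) = 0" by (simp add: algebra_simps)
    moreover have "int m - 1 \<noteq> 0" using i j False by auto
    ultimately show ?thesis using False by (simp add: q_def)
  qed
qed

section \<open>The bordered skew-Hadamard matrix\<close>

text \<open>I + S with an extra first row and column; the two borders have opposite signs so that
  subtracting the identity leaves a skew matrix.\<close>

definition bordered :: "nat \<Rightarrow> nat \<Rightarrow> real" where
  "bordered i j = (case i of 0 \<Rightarrow> 1 | Suc i' \<Rightarrow>
    (case j of 0 \<Rightarrow> - 1 | Suc j' \<Rightarrow> of_bool (i' = j') + of_int (s i' j')))"

lemma bordered_simps [simp]:
  "bordered 0 j = 1" "bordered (Suc i) 0 = - 1"
  "bordered (Suc i) (Suc j) = of_bool (i = j) + of_int (s i j)"
  by (simp_all add: bordered_def)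

text \<open>By skewness (I + S) times its transpose is I - S squared = (m + 1) I - J, and the border
  adds J back. The first row is orthogonal to the others because every row of I + S sums to
  1.\<close>

lemma bordered_row_mult:
  assumes sq: "\<And>i j. i < m \<Longrightarrow> j < m \<Longrightarrow>
      (\<Sum>l<m. s i l * s l j) = (if i = j then 1 - int m else 1)"
    and i: "i < Suc m" and j: "j < Suc m"
  shows "(\<Sum>l<Suc m. bordered i l * bordered j l) = (if i = j then of_nat (Suc m) else 0)"
proof -
  have row: "(\<Sum>l<m. of_bool (i = l) + real_of_int (s i l)) = 1" if "i < m" for i
    using that row_sum[OF that] by (simp add: sum.distrib flip: of_int_sum)
  show ?thesis
  proof (cases i)
    case 0
    show ?thesis
    proof (cases j)
      case (Suc j')
      then show ?thesis using 0 j row[of j']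
        by (simp add: sum.lessThan_Suc_shift del: sum.lessThan_Suc)
    qed (simp add: 0 sum.lessThan_Suc_shift del: sum.lessThan_Suc)
  next
    case i': (Suc i')
    show ?thesis
    proof (cases j)
      case 0
      then show ?thesis using i i' row[of i']
        by (simp add: sum.lessThan_Suc_shift sum_negf del: sum.lessThan_Suc)
    next
      case j': (Suc j')
      have ij: "i' < m" "j' < m" using i j i' j' by auto
      have "(\<Sum>l<m. (of_bool (i' = l) + s i' l) * (of_bool (j' = l) + s j' l)) =
          (\<Sum>l<m. (if l = i' then of_bool (i' = j') + s j' i' else 0)
            + (if l = j' then s i' j' else 0) - s i' l * s l j')"
        using ij skew[of j'] by (intro sum.cong refl) (auto simp: algebra_simps)
      also have "\<dots> = of_bool (i' = j') - (\<Sum>l<m. s i' l * s l j')"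
        using ij skew[of i' j'] by (simp add: sum.distrib sum_subtractf)
      also have "\<dots> = (if i' = j' then int m else - 1)"
        using sq[OF ij] by simp
      finally have "real_of_int (\<Sum>l<m. (of_bool (i' = l) + s i' l) * (of_bool (j' = l) + s j' l)) =
          real_of_int (if i' = j' then int m else - 1)" by (rule arg_cong)
      then have "(\<Sum>l<m. (of_bool (i' = l) + real_of_int (s i' l)) *
          (of_bool (j' = l) + real_of_int (s j' l))) = (if i' = j' then of_nat m else - 1)"
        by (simp split: if_splits)
      then show ?thesis
        using i' j' by (simp add: sum.lessThan_Suc_shift del: sum.lessThan_Suc)
    qed
  qed
qed

lemma skew_hadamard_bordered:
  assumes "\<And>i j. i < m \<Longrightarrow> j < m \<Longrightarrow>
      (\<Sum>l<m. s i l * s l j) = (if i = j then 1 - int m else 1)"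
  shows "skew_hadamard_matrix (Suc m) (mat (Suc m) (Suc m) (\<lambda>(i, j). bordered i j))"
proof -
  let ?A = "mat (Suc m) (Suc m) (\<lambda>(i, j). bordered i j)"
  have A: "?A \<in> carrier_mat (Suc m) (Suc m)" by simp
  have entries: "bordered i j \<in> {1, - 1}" if "i < Suc m" "j < Suc m" for i j
  proof (cases i)
    case (Suc i')
    have "s i' j' = 1 \<or> s i' j' = - 1" if "j = Suc j'" "i' \<noteq> j'" for j'
      using that Suc \<open>i < Suc m\<close> \<open>j < Suc m\<close> by (intro sign) auto
    then show ?thesis using Suc \<open>i < Suc m\<close> by (cases j) force+
  qed simp
  have "elements_mat ?A \<subseteq> {1, - 1}"
  proof
    fix x assume "x \<in> elements_mat ?A"
    then obtain i j where "i < Suc m" "j < Suc m" "x = bordered i j"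
      by (auto simp: elements_mat_def simp del: upt_Suc)
    then show "x \<in> {1, - 1}" using entries by blast
  qed
  moreover have "?A * transpose_mat ?A = of_nat (Suc m) \<cdot>\<^sub>m 1\<^sub>m (Suc m)"
    using bordered_row_mult[OF assms]
    by (intro eq_matI) (simp_all add: scalar_prod_def atLeast0LessThan del: sum.lessThan_Suc)
  moreover have "transpose_mat (?A - 1\<^sub>m (Suc m)) = - (?A - 1\<^sub>m (Suc m))"
  proof (rule eq_matI)
    fix i j
    assume "i < dim_row (- (?A - 1\<^sub>m (Suc m)))" "j < dim_col (- (?A - 1\<^sub>m (Suc m)))"
    then have ij: "i < Suc m" "j < Suc m" by simp_all
    \<comment> \<open>Skewness of A - I, rewritten as: A plus its transpose is 2 I.\<close>
    have "bordered j i + bordered i j = 2 * of_bool (i = j)"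
    proof (cases i)
      case 0
      then show ?thesis by (cases j) simp_all
    next
      case i': (Suc i')
      show ?thesis
      proof (cases j)
        case (Suc j')
        then have "s j' i' = - s i' j'" using ij i' by (intro skew) auto
        then show ?thesis using Suc i' by simp
      qed (simp add: i')
    qed
    then show "transpose_mat (?A - 1\<^sub>m (Suc m)) $$ (i, j) = (- (?A - 1\<^sub>m (Suc m))) $$ (i, j)"
      using ij by (cases "i = j") simp_all
  qed simp_all
  ultimately show ?thesis
    using A by (simp add: skew_hadamard_matrix_def hadamard_matrix_def skew_symmetric_mat_def)
qed

end

subsection \<open>Tournaments\<close>

text \<open>Completeness is a property of the symmetrization, whose arcs come from arcs of
  \<open>T\<close> in one of the two directions.\<close>

lemma tournament_adj:
  assumes "tournament T"
  shows "u \<rightarrow>\<^bsub>T\<^esub> v \<Longrightarrow> \<not> v \<rightarrow>\<^bsub>T\<^esub> u"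
    and "u \<in> verts T \<Longrightarrow> v \<in> verts T \<Longrightarrow> u \<noteq> v \<Longrightarrow> u \<rightarrow>\<^bsub>T\<^esub> v \<or> v \<rightarrow>\<^bsub>T\<^esub> u"
proof -
  show "u \<rightarrow>\<^bsub>T\<^esub> v \<Longrightarrow> \<not> v \<rightarrow>\<^bsub>T\<^esub> u"
    using assms by (auto simp: tournament_def oriented_graph_def)
  assume "u \<in> verts T" "v \<in> verts T" "u \<noteq> v"
  then have "(u, v) \<in> arcs_ends (with_proj (mk_symmetric T))"
    using assms by (auto simp: tournament_def complete_digraph_def)
  then show "u \<rightarrow>\<^bsub>T\<^esub> v \<or> v \<rightarrow>\<^bsub>T\<^esub> u"
    by (auto simp: parcs_mk_symmetric arcs_ends_def arc_to_ends_def)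
qed

text \<open>Degrees count arcs; without parallel arcs, an arc leaving \<open>u\<close> is determined
  by its head.\<close>

lemma (in digraph) out_degree_eq_card_adj: "out_degree G u = card {v. u \<rightarrow> v}"
proof -
  have "inj_on (head G) (out_arcs G u)"
    using no_multi_arcs by (auto simp: inj_on_def arc_to_ends_def)
  moreover have "head G ` out_arcs G u = {v. u \<rightarrow> v}"
    by (auto simp: arcs_ends_def arc_to_ends_def)
  ultimately show ?thesis unfolding out_degree_def by (metis card_image)
qed

lemma (in digraph) in_degree_eq_card_adj: "in_degree G v = card {u. u \<rightarrow> v}"
proof -
  have "inj_on (tail G) (in_arcs G v)"
    using no_multi_arcs by (auto simp: inj_on_def arc_to_ends_def)
  moreover have "tail G ` in_arcs G v = {u. u \<rightarrow> v}"
    by (auto simp: arcs_ends_def arc_to_ends_def)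
  ultimately show ?thesis unfolding in_degree_def by (metis card_image)
qed

lemma sum_nth_of_bool:
  assumes "distinct xs" and "\<And>x. P x \<Longrightarrow> x \<in> set xs"
  shows "(\<Sum>i<length xs. of_bool (P (xs ! i))) = int (card {x. P x})"
proof -
  have "(\<Sum>i<length xs. of_bool (P (xs ! i))) = (\<Sum>x\<in>set xs. of_bool (P x) :: int)"
    by (rule sum.reindex_bij_betw[OF bij_betw_nth[OF assms(1) refl refl]])
  also have "\<dots> = int (card (set xs \<inter> {x. P x}))" by (simp add: sum_of_bool_eq)
  also have "set xs \<inter> {x. P x} = {x. P x}" using assms(2) by auto
  finally show ?thesis .
qed

theorem theorem3p2:
  fixes T :: "('a, 'b) pre_digraph" and vs :: "'a list" and n :: nat
  assumes "regular_tournament T"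
    and "card (verts T) + 1 = n"
    and "distinct vs" and "set vs = verts T"
    and "card (spectrum (H_omega T vs)) = 3"
  shows "\<exists>A. skew_hadamard_matrix n A"
proof -
  have T: "tournament T" using assms(1) by (simp add: regular_tournament_def)
  then interpret digraph T by (simp add: tournament_def oriented_graph_def)
  define m where "m = length vs"
  have n: "n = Suc m" using assms(2-4) distinct_card[of vs] by (simp add: m_def)
  define s :: "nat \<Rightarrow> nat \<Rightarrow> int" where
    "s i j = of_bool (vs ! i \<rightarrow>\<^bsub>T\<^esub> vs ! j) - of_bool (vs ! j \<rightarrow>\<^bsub>T\<^esub> vs ! i)" for i j
  interpret regular_sign_matrix m s
  proof
    fix i j assume ij: "i < m" "j < m"
    show "s j i = - s i j" by (simp add: s_def)
    assume "i \<noteq> j"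
    then have "vs ! i \<noteq> vs ! j"
      using ij assms(3) by (simp add: m_def nth_eq_iff_index_eq)
    moreover have "vs ! i \<in> verts T" "vs ! j \<in> verts T"
      using ij nth_mem[of _ vs] by (simp_all add: m_def flip: assms(4))
    ultimately have "vs ! i \<rightarrow>\<^bsub>T\<^esub> vs ! j \<or> vs ! j \<rightarrow>\<^bsub>T\<^esub> vs ! i"
      by (intro tournament_adj(2)[OF T])
    then show "s i j = 1 \<or> s i j = - 1"
      using tournament_adj(1)[OF T] by (elim disjE) (simp_all add: s_def)
  next
    fix i assume i: "i < m"
    then have "vs ! i \<in> verts T" using nth_mem[of i vs] by (simp add: m_def flip: assms(4))
    then have "in_degree T (vs ! i) = out_degree T (vs ! i)"
      using assms(1) by (auto simp: regular_tournament_def)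
    moreover have "(\<Sum>j<m. of_bool (vs ! i \<rightarrow>\<^bsub>T\<^esub> vs ! j)) = int (out_degree T (vs ! i))"
      unfolding m_def out_degree_eq_card_adj
      using assms(3,4) adj_in_verts(2)
      by (intro sum_nth_of_bool[where P = "\<lambda>v. vs ! i \<rightarrow>\<^bsub>T\<^esub> v"]) auto
    moreover have "(\<Sum>j<m. of_bool (vs ! j \<rightarrow>\<^bsub>T\<^esub> vs ! i)) = int (in_degree T (vs ! i))"
      unfolding m_def in_degree_eq_card_adj
      using assms(3,4) adj_in_verts(1)
      by (intro sum_nth_of_bool[where P = "\<lambda>v. v \<rightarrow>\<^bsub>T\<^esub> vs ! i"]) auto
    ultimately show "(\<Sum>j<m. s i j) = 0" by (simp add: s_def sum_subtractf)
  qed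
  \<comment> \<open>\<open>omega\<close> and its conjugate are (1 + \<i> \<surd>3 s) / 2 for s = 1
    and s = - 1; asymmetry excludes loops, so both diagonals are zero.\<close>
  have "H_omega T vs = H"
  proof (rule eq_matI)
    fix i j assume "i < dim_row H" "j < dim_col H"
    then have ij: "i < m" "j < m" by simp_all
    show "H_omega T vs $$ (i, j) = H $$ (i, j)"
      using ij sign[OF ij] tournament_adj(1)[OF T, of "vs ! i" "vs ! j"]
      by (cases "i = j") (auto simp: H_omega_def m_def[symmetric] h_def omega_def s_def of_bool_def
          split: if_splits)
  qed (simp_all add: H_omega_def m_def)
  then have "card (spectrum H) = 3" using assms(5) by simp
  from skew_hadamard_bordered[OF sum_s_mult[OF this]] show ?thesis unfolding n by (rule exI)
qed

end
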